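(* Let $q$ be a prime power, let $0<p\le 1$, put $n=\left\lceil \frac1p\right\rceil$, and suppose $q>(n-1)\left[\frac{(n-2)^2}{2}+1\right]$. Then $$\omega(\mathrm{CHSH}_q(p))\ge p+\frac{n-1}{q}\left(1-\frac{np}{2}\right).$$
   Context: Let $\mathbb{F}_q$ be the finite field with $q$ elements. $\mathrm{CHSH}_q(p)$ is the family of two-player games, one for each probability distribution $r$ on $\mathbb{F}_q$ with $\max_{x\in\mathbb{F}_q} r(x)\le p$: Alice receives $x\in\mathbb{F}_q$ drawn according to $r$, Bob receives $y\in\mathbb{F}_q$ drawn uniformly and independently of $x$; without communicating they output $a,b\in\mathbb{F}_q$ respectively, and win iff $a+b=xy$ in $\mathbb{F}_q$. Only deterministic classical strategies are considered, i.e. pairs of functions $a,b:\mathbb{F}_q\to\mathbb{F}_q$ (Alice answers $a(x)$, Bob answers $b(y)$). For such a strategy the winning probability is $$\omega(q,p,r,a,b)=\sum_{x,y\in\mathbb{F}_q}\frac1q\, r(x)\,V(a,b,x,y),$$ where $V(a,b,x,y)=1$ if $a(x)+b(y)=xy$ and $0$ otherwise. The classical value of the family is $$\omega(\mathrm{CHSH}_q(p))=\max_{r}\max_{a,b}\ \omega(q,p,r,a,b),$$ the maximum being over all probability distributions $r$ on $\mathbb{F}_q$ with $\max_x r(x)\le p$ and all functions $a,b:\mathbb{F}_q\to\mathbb{F}_q$. *)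

theory Defs
  imports "HOL-Probability.Probability"
begin

definition chsh_inputs :: "real \<Rightarrow> 'a::finite pmf set" where
  "chsh_inputs p = {r. (MAX x. pmf r x) \<le> p}"

definition chsh_wins :: "('a::field \<Rightarrow> 'a) \<Rightarrow> ('a \<Rightarrow> 'a) \<Rightarrow> 'a \<Rightarrow> 'a \<Rightarrow> bool" where
  "chsh_wins a b x y \<longleftrightarrow> a x + b y = x * y"

definition chsh_win_prob ::
  "'a::{field,finite} pmf \<Rightarrow> ('a \<Rightarrow> 'a) \<Rightarrow> ('a \<Rightarrow> 'a) \<Rightarrow> real" where
  "chsh_win_prob r a b =
     (\<Sum>x\<in>UNIV. \<Sum>y\<in>UNIV. 1 / real CARD('a) * pmf r x * (if chsh_wins a b x y then 1 else 0))"

text \<open>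
  The field is passed as a type. The outer maximum ranges over an infinite set, for which
  \<^const>\<open>Max\<close> is unspecified, so it is written as a supremum; it is attained
  whenever some admissible distribution exists, see \<open>chsh_value_attained\<close> below.
\<close>

definition chsh_value :: "'a::{field,finite} itself \<Rightarrow> real \<Rightarrow> real" where
  "chsh_value _ p =
     (SUP r\<in>(chsh_inputs p :: 'a pmf set). MAX (a, b). chsh_win_prob r a b)"

lemma chsh_inputs_iff: "r \<in> chsh_inputs p \<longleftrightarrow> (\<forall>x. pmf r x \<le> p)"
  by (simp add: chsh_inputs_def)

lemma chsh_inputs_nonempty:
  assumes "1 / real CARD('a::finite) \<le> p"
  shows "(chsh_inputs p :: 'a pmf set) \<noteq> {}"
proof -
  have "pmf_of_set (UNIV :: 'a set) \<in> chsh_inputs p"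
    using assms by (simp add: chsh_inputs_iff)
  then show ?thesis by blast
qed

lemma chsh_win_prob_max:
  fixes a b :: "'a::{field,finite} \<Rightarrow> 'a"
  assumes ne: "(chsh_inputs p :: 'a pmf set) \<noteq> {}"
  shows "\<exists>r\<in>chsh_inputs p. \<forall>s\<in>chsh_inputs p. chsh_win_prob s a b \<le> chsh_win_prob r a b"
proof -
  define K where "K = {v :: (real, 'a) vec. (\<forall>i. 0 \<le> v $ i \<and> v $ i \<le> p) \<and> (\<Sum>i\<in>UNIV. v $ i) = 1}"
  define f where "f v = (\<Sum>x\<in>UNIV. \<Sum>y\<in>UNIV. 1 / real CARD('a) * (v $ x) *
     (if chsh_wins a b x y then 1 else 0))" for v :: "(real, 'a) vec"
  have cl: "closed K" unfolding K_def
    by (intro closed_Collect_conj closed_Collect_all closed_Collect_le closed_Collect_eq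
        continuous_intros)
  have "K \<subseteq> cbox 0 (\<chi> i. p)"
    by (auto simp: K_def mem_box_cart)
  then have "bounded K" using bounded_cbox bounded_subset by blast
  with cl have comp: "compact K" by (simp add: compact_eq_bounded_closed)
  have in_K: "(\<chi> i. pmf r i) \<in> K" if "r \<in> chsh_inputs p" for r
    using that sum_pmf_eq_1[of UNIV r] by (simp add: K_def chsh_inputs_iff)
  have f_pmf: "f (\<chi> i. pmf r i) = chsh_win_prob r a b" for r
    by (simp add: f_def chsh_win_prob_def)
  have "K \<noteq> {}" using ne in_K by blast
  moreover have "continuous_on K f" unfolding f_def by (intro continuous_intros)
  ultimately obtain v where v: "v \<in> K" "\<And>w. w \<in> K \<Longrightarrow> f w \<le> f v"
    using continuous_attains_sup[OF comp] by blast
  define r where "r = embed_pmf (\<lambda>i. v $ i)"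
  have pr: "pmf r i = v $ i" for i
    unfolding r_def
    using v(1) by (subst pmf_embed_pmf)
      (auto simp: K_def nn_integral_count_space_finite sum_ennreal)
  have "r \<in> chsh_inputs p" using v(1) by (simp add: chsh_inputs_iff pr K_def)
  moreover have "chsh_win_prob s a b \<le> chsh_win_prob r a b" if "s \<in> chsh_inputs p" for s
    using v(2)[OF in_K[OF that]] f_pmf[of s] f_pmf[of r] by (simp add: pr)
  ultimately show ?thesis by blast
qed

lemma chsh_value_attained:
  assumes ne: "(chsh_inputs p :: 'a::{field,finite} pmf set) \<noteq> {}"
  shows "\<exists>r\<in>chsh_inputs p. \<exists>a b. chsh_value TYPE('a) p = chsh_win_prob (r :: 'a pmf) a b"
    and "r \<in> chsh_inputs p \<Longrightarrow> chsh_win_prob (r :: 'a pmf) a b \<le> chsh_value TYPE('a) p"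
proof -
  let ?w = "\<lambda>r (a, b). chsh_win_prob (r :: 'a pmf) a b"
  obtain R where R: "\<And>ab. R ab \<in> chsh_inputs p"
    "\<And>ab s. s \<in> chsh_inputs p \<Longrightarrow> ?w s ab \<le> ?w (R ab) ab"
  proof -
    have "\<forall>ab. \<exists>r\<in>chsh_inputs p. \<forall>s\<in>chsh_inputs p. ?w s ab \<le> ?w r ab"
      using chsh_win_prob_max[OF ne] by auto
    then show ?thesis using that by metis
  qed
  define M where "M = Max (range (\<lambda>ab. ?w (R ab) ab))"
  have "M \<in> range (\<lambda>ab. ?w (R ab) ab)" unfolding M_def by (rule Max_in) auto
  then obtain ab where ab: "M = ?w (R ab) ab" by blast
  have le_M: "?w s cd \<le> M" if "s \<in> chsh_inputs p" for s cd
  proof -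
    have "?w (R cd) cd \<le> M" unfolding M_def by (rule Max_ge) auto
    with R(2)[OF that, of cd] show ?thesis by linarith
  qed
  have in_le_M: "Max (range (?w s)) \<le> M" if "s \<in> chsh_inputs p" for s
    using le_M[OF that] by (subst Max_le_iff) auto
  have bdd: "bdd_above ((\<lambda>r. Max (range (?w r))) ` chsh_inputs p)"
    using in_le_M by (auto intro!: bdd_aboveI[of _ M])
  have le_val: "?w s cd \<le> chsh_value TYPE('a) p" if "s \<in> chsh_inputs p" for s cd
  proof -
    have "?w s cd \<le> Max (range (?w s))" by (rule Max_ge) auto
    also have "\<dots> \<le> chsh_value TYPE('a) p"
      unfolding chsh_value_def using that bdd by (rule cSUP_upper)
    finally show ?thesis .
  qed
  have "chsh_value TYPE('a) p \<le> M"
    unfolding chsh_value_def using ne in_le_M by (rule cSUP_least)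
  with le_val[OF R(1), of ab ab] ab have "chsh_value TYPE('a) p = ?w (R ab) ab" by linarith
  then show "\<exists>r\<in>chsh_inputs p. \<exists>a b. chsh_value TYPE('a) p = chsh_win_prob (r :: 'a pmf) a b"
    using R(1)[of ab] by (cases ab) auto
  show "chsh_win_prob r a b \<le> chsh_value TYPE('a) p" if "r \<in> chsh_inputs p" for r :: "'a pmf" and a b
    using le_val[OF that, of "(a, b)"] by simp
qed

end

theory Submission
  imports Defs
begin

text \<open>
  A strategy is a line \<open>b = x * y - a x\<close> of slope \<open>x\<close> for each input of Alice together with a
  point \<open>(y, b y)\<close> for each input of Bob, and it wins where the point lies on the line. Let \<open>r\<close>
  put mass \<open>p\<close> on \<open>n - 1\<close> slopes and the remaining mass on one more. Greedily, the
  intercepts of these \<open>n\<close> lines can be chosen so that no two pairs of lines meet over the same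
  \<open>y\<close>. Over a crossing of the lines \<open>x, x'\<close> Bob gains \<open>r x + r x'\<close>, elsewhere he gains \<open>p\<close> on a
  heaviest line, and summing \<open>r x + r x' - p\<close> over all pairs gives the bound.
\<close>

definition crosses :: "('a::field \<Rightarrow> 'a) \<Rightarrow> 'a \<Rightarrow> 'a \<Rightarrow> 'a \<Rightarrow> bool" where
  "crosses c y x x' \<longleftrightarrow> x * y - c x = x' * y - c x'"

text \<open>Pairs are compared as sets because \<open>crosses\<close> is symmetric. Excluded are
  three concurrent lines as well as two disjoint pairs that meet over the same \<open>y\<close> at
  different heights.\<close>

definition simple_crossings :: "'a::field set \<Rightarrow> ('a \<Rightarrow> 'a) \<Rightarrow> bool" where
  "simple_crossings S c \<longleftrightarrow>
     (\<forall>y. \<forall>x\<in>S. \<forall>x'\<in>S. \<forall>u\<in>S. \<forall>u'\<in>S. x \<noteq> x' \<longrightarrow> u \<noteq> u' \<longrightarrow>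
        crosses c y x x' \<longrightarrow> crosses c y u u' \<longrightarrow> {x, x'} = {u, u'})"

lemma simple_crossingsD:
  "simple_crossings S c \<Longrightarrow> x \<in> S \<Longrightarrow> x' \<in> S \<Longrightarrow> u \<in> S \<Longrightarrow> u' \<in> S \<Longrightarrow> x \<noteq> x' \<Longrightarrow> u \<noteq> u' \<Longrightarrow>
     crosses c y x x' \<Longrightarrow> crosses c y u u' \<Longrightarrow> {x, x'} = {u, u'}"
  unfolding simple_crossings_def by blast

lemma crosses_iff: "x \<noteq> x' \<Longrightarrow> crosses c y x x' \<longleftrightarrow> y = (c x - c x') / (x - x')"
  by (auto simp: crosses_def field_simps)

lemma crosses_sym: "crosses c y x x' \<longleftrightarrow> crosses c y x' x"
  unfolding crosses_def by metis

text \<open>Lines of different slopes meet over only one \<open>y\<close>, so a pair of lines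
  determines its crossing point and there are no more such points than pairs.\<close>

lemma card_crossing_points:
  fixes F :: "'a::{field,finite} set"
  shows "card {y. \<exists>x\<in>F. \<exists>x'\<in>F. x \<noteq> x' \<and> crosses c y x x'} \<le> card F choose 2"
proof -
  let ?r = "\<lambda>y T. \<exists>x x'. T = {x, x'} \<and> x \<noteq> x' \<and> crosses c y x x'"
  have "card {y. \<exists>x\<in>F. \<exists>x'\<in>F. x \<noteq> x' \<and> crosses c y x x'} \<le> card {T. T \<subseteq> F \<and> card T = 2}"
  proof (rule card_le_if_inj_on_rel[where r = ?r])
    fix y assume "y \<in> {y. \<exists>x\<in>F. \<exists>x'\<in>F. x \<noteq> x' \<and> crosses c y x x'}"
    then obtain x x' where "x \<in> F" "x' \<in> F" "x \<noteq> x'" "crosses c y x x'" by blast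
    then show "\<exists>T. T \<in> {T. T \<subseteq> F \<and> card T = 2} \<and> ?r y T"
      by (intro exI[of _ "{x, x'}"]) auto
  next
    fix y z T assume "?r y T" "?r z T"
    then obtain x x' u u' where "T = {x, x'}" "x \<noteq> x'" "crosses c y x x'"
      "T = {u, u'}" "u \<noteq> u'" "crosses c z u u'" by blast
    moreover from this have "crosses c z x x'"
      using crosses_sym by (metis doubleton_eq_iff)
    ultimately show "y = z" by (simp add: crosses_iff)
  qed simp
  then show ?thesis by (simp add: n_subsets)
qed

text \<open>The new line must avoid every old line over every old crossing. There are at most
  \<open>card F choose 2\<close> such \<open>y\<close>, and over each of them two old lines
  coincide, leaving at most \<open>card F - 1\<close> heights to avoid. So fewer than
  \<open>CARD('a)\<close> intercepts are forbidden.\<close>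

lemma simple_crossings_insert:
  fixes F :: "'a::{field,finite} set"
  assumes F: "simple_crossings F c" and x0: "x0 \<notin> F"
    and small: "(card F - 1) * (card F choose 2) < CARD('a)"
  shows "\<exists>c. simple_crossings (insert x0 F) c"
proof -
  define Y where "Y = {y. \<exists>x\<in>F. \<exists>x'\<in>F. x \<noteq> x' \<and> crosses c y x x'}"
  \<comment> \<open>The forbidden values of \<open>c x0\<close>: those for which the line of slope
    \<open>x0\<close> meets a line of \<open>F\<close> over a point of \<open>Y\<close>.\<close>
  define B where "B = (\<Union>y\<in>Y. (\<lambda>x. x0 * y - (x * y - c x)) ` F)"
  have "card ((\<lambda>x. x0 * y - (x * y - c x)) ` F) \<le> card F - 1" if "y \<in> Y" for y
  proof -
    obtain x x' where "x \<in> F" "x' \<in> F" "x \<noteq> x'" "x * y - c x = x' * y - c x'"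
      using \<open>y \<in> Y\<close> by (auto simp: Y_def crosses_def)
    then have "\<not> inj_on (\<lambda>x. x0 * y - (x * y - c x)) F"
      unfolding inj_on_def by metis
    then have "card ((\<lambda>x. x0 * y - (x * y - c x)) ` F) \<noteq> card F"
      using eq_card_imp_inj_on[OF finite] by metis
    with card_image_le[OF finite, of "\<lambda>x. x0 * y - (x * y - c x)" F] show ?thesis by linarith
  qed
  then have "card B \<le> card Y * (card F - 1)"
    unfolding B_def by (intro order_trans[OF card_UN_le[OF finite]] order_trans[OF sum_bounded_above]) auto
  also have "\<dots> \<le> (card F choose 2) * (card F - 1)"
    using card_crossing_points[of F c] unfolding Y_def by simp
  also have "\<dots> < CARD('a)" using small by (simp add: mult.commute)
  finally have "B \<noteq> UNIV" by auto
  then obtain c0 where "c0 \<notin> B" by blast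
  define d where "d = c(x0 := c0)"
  have old: "crosses d y x x' \<longleftrightarrow> crosses c y x x'" if "x \<in> F" "x' \<in> F" for y x x'
    using that x0 by (auto simp: crosses_def d_def)
  have new: "y \<notin> Y" if "crosses d y x0 x" "x \<in> F" for x y
  proof
    assume "y \<in> Y"
    moreover have "c0 = x0 * y - (x * y - c x)"
      using that x0 by (auto simp: crosses_def d_def algebra_simps split: if_splits)
    ultimately show False using \<open>c0 \<notin> B\<close> \<open>x \<in> F\<close> unfolding B_def by blast
  qed
  have YI: "y \<in> Y" if "x \<in> F" "x' \<in> F" "x \<noteq> x'" "crosses d y x x'" for x x' y
    using that old unfolding Y_def by blast
  \<comment> \<open>A crossing with the new line lies outside \<open>Y\<close>, so any pair meeting
    over the same \<open>y\<close> also contains \<open>x0\<close>. If its other line were not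
    \<open>x\<close>, that line and \<open>x\<close> would meet over \<open>y\<close>, forcing
    \<open>y\<close> into \<open>Y\<close>.\<close>
  have unique: "{x0, x} = {u, u'}"
    if x: "crosses d y x0 x" "x \<in> F" and u: "u \<in> insert x0 F" "u' \<in> insert x0 F" "u \<noteq> u'" "crosses d y u u'"
    for y x u u'
  proof -
    have y: "y \<notin> Y" using new x by blast
    then have "u = x0 \<or> u' = x0" using YI u by blast
    then obtain v where v: "{u, u'} = {x0, v}" "v \<in> F" "crosses d y x0 v"
      using u crosses_sym by (metis insert_commute insertE)
    have "crosses d y x v" using x v by (simp add: crosses_def)
    with YI y v x have "x = v" by blast
    with v show ?thesis by simp
  qed
  have "simple_crossings (insert x0 F) d"
    unfolding simple_crossings_def
  proof (intro allI ballI impI)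
    fix y x x' u u'
    assume *: "x \<in> insert x0 F" "x' \<in> insert x0 F" "u \<in> insert x0 F" "u' \<in> insert x0 F"
      "x \<noteq> x'" "u \<noteq> u'" "crosses d y x x'" "crosses d y u u'"
    consider "x = x0" | "x' = x0" | "u = x0" | "u' = x0"
      | "x \<in> F" "x' \<in> F" "u \<in> F" "u' \<in> F" using * by blast
    then show "{x, x'} = {u, u'}"
    proof cases
      case 1 then show ?thesis using unique[of y x' u u'] * by auto
    next
      case 2 then show ?thesis using unique[of y x u u'] * crosses_sym[of d y x x'] by auto
    next
      case 3 then show ?thesis using unique[of y u' x x'] * by auto
    next
      case 4 then show ?thesis using unique[of y u x x'] * crosses_sym[of d y u u'] by auto
    next
      case 5 then show ?thesis using simple_crossingsD[OF F] * old by blast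
    qed
  qed
  then show ?thesis by blast
qed

lemma ex_simple_crossings:
  fixes S :: "'a::{field,finite} set"
  assumes "(card S - 2) * ((card S - 1) choose 2) < CARD('a)"
  shows "\<exists>c. simple_crossings S c"
  using finite[of S] assms
proof (induction S rule: finite_induct)
  case empty
  then show ?case by (simp add: simple_crossings_def)
next
  case (insert x F)
  have less: "(card F - 1) * (card F choose 2) < CARD('a)" using insert by simp
  \<comment> \<open>The bound grows with the number of lines, so the one for the last insertion
    covers all earlier ones.\<close>
  have "(card F - 2) * ((card F - 1) choose 2) \<le> (card F - 1) * (card F choose 2)"
    by (intro mult_le_mono binomial_right_mono) auto
  with insert.IH less obtain c where "simple_crossings F c" by fastforce
  then show ?case using insert(2) less by (rule simple_crossings_insert)
qed

text \<open>All points of \<open>S\<close> but one get mass \<open>p\<close>, and \<open>z\<close>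
  gets the rest. The two bounds on \<open>card S\<close> say that this rest is positive and at most
  \<open>p\<close>.\<close>

lemma ex_concentrated_pmf:
  fixes S :: "'a::finite set" and p :: real
  assumes p: "0 < p" "p \<le> 1" and S: "1 / p \<le> card S" "real (card S) - 1 < 1 / p"
  shows "\<exists>r :: 'a pmf. (\<forall>x. pmf r x \<le> p) \<and> (\<forall>x. x \<notin> S \<longrightarrow> pmf r x = 0) \<and> (\<exists>x\<in>S. pmf r x = p)"
proof -
  have "0 < 1 / p" using p by simp
  with S(1) have "card S > 0" by linarith
  then obtain z where z: "z \<in> S" by fastforce
  define f where "f x = (if x \<notin> S then 0 else if x = z then 1 - (real (card S) - 1) * p else p)" for x
  have le: "1 \<le> card S * p" and ge: "(real (card S) - 1) * p < 1"
    using S p by (simp_all add: field_simps)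
  have f0: "0 \<le> f x" and fp: "f x \<le> p" for x
    using p le ge by (auto simp: f_def algebra_simps)
  have "sum f UNIV = sum f S" by (rule sum.mono_neutral_right) (auto simp: f_def)
  also have "\<dots> = f z + sum f (S - {z})" using z by (simp add: sum.remove)
  also have "sum f (S - {z}) = (\<Sum>x\<in>S - {z}. p)" by (rule sum.cong) (auto simp: f_def)
  also have "\<dots> = (real (card S) - 1) * p" using z \<open>card S > 0\<close> by (simp add: of_nat_diff)
  finally have "sum f UNIV = 1" using z by (simp add: f_def)
  then have pmf: "pmf (embed_pmf f) x = f x" for x
    using f0 by (subst pmf_embed_pmf) (auto simp: nn_integral_count_space_finite sum_ennreal)
  have "\<exists>x\<in>S. f x = p"
  proof (cases "S = {z}")
    \<comment> \<open>Here the rest is the whole mass 1, and \<open>1 \<le> card S * p\<close>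
      forces \<open>p = 1\<close>.\<close>
    case True
    then have "f z = p" using p le by (simp add: f_def)
    with z show ?thesis by blast
  next
    case False
    with z obtain x where "x \<in> S" "x \<noteq> z" by blast
    then show ?thesis by (intro bexI[of _ x]) (auto simp: f_def)
  qed
  with fp show ?thesis by (intro exI[of _ "embed_pmf f"]) (auto simp: pmf f_def)
qed

text \<open>With N = \<open>card S\<close>, each \<open>r x\<close> occurs 2(N - 1) times and
  \<open>p\<close> occurs N(N - 1) times.\<close>

lemma sum_ordered_pairs:
  fixes r :: "'a \<Rightarrow> real" and p :: real
  assumes "finite S" "sum r S = 1"
  shows "(\<Sum>x\<in>S. \<Sum>x'\<in>S - {x}. r x + r x' - p) = 2 * (real (card S) - 1) * (1 - card S * p / 2)"
proof -
  have "(\<Sum>x'\<in>S - {x}. r x + r x' - p) = card S * r x + 1 - card S * p - 2 * r x + p" if "x \<in> S" for x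
  proof -
    have "card S > 0" using assms(1) that card_gt_0_iff by blast
    then have "real (card S - 1) = real (card S) - 1" by linarith
    then show ?thesis
      using assms that by (simp add: sum_diff1 sum.distrib sum_subtractf algebra_simps)
  qed
  then have "(\<Sum>x\<in>S. \<Sum>x'\<in>S - {x}. r x + r x' - p)
      = (\<Sum>x\<in>S. card S * r x + 1 - card S * p - 2 * r x + p)" by simp
  also have "\<dots> = card S * 1 + card S - card S * (card S * p) - 2 * 1 + card S * p"
    using assms by (simp add: sum.distrib sum_subtractf flip: sum_distrib_left)
  finally show ?thesis by (simp add: algebra_simps)
qed

lemma chsh_win_prob_simple_crossings:
  fixes r :: "'a::{field,finite} pmf" and p :: real
  assumes c: "simple_crossings S c"
    and supp: "\<And>x. x \<notin> S \<Longrightarrow> pmf r x = 0" and heavy: "x1 \<in> S" "pmf r x1 = p"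
  shows "\<exists>b. chsh_win_prob r c b \<ge> p + (real (card S) - 1) / CARD('a) * (1 - card S * p / 2)"
proof -
  let ?h = "\<lambda>x x'. pmf r x + pmf r x' - p"
  define P where "P = (SIGMA x:S. S - {x})"
  \<comment> \<open>\<open>P\<close> holds each pair in both orders, hence the halves. Over a given
    \<open>y\<close> the sum is either empty, and Bob picks the point on the heavy line
    \<open>x1\<close>, or it is the gain of the only crossing pair, and Bob picks their common
    point.\<close>
  have "\<exists>v. p + (\<Sum>(x, x')\<in>{(x, x')\<in>P. crosses c y x x'}. ?h x x' / 2)
      \<le> (\<Sum>x\<in>UNIV. if c x + v = x * y then pmf r x else 0)" (is "\<exists>v. ?Q y v") for y
  proof (cases "{(x, x')\<in>P. crosses c y x x'} = {}")
    case True
    have "p = (\<Sum>x\<in>{x1}. if c x + (x1 * y - c x1) = x * y then pmf r x else 0)"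
      using heavy by simp
    also have "\<dots> \<le> (\<Sum>x\<in>UNIV. if c x + (x1 * y - c x1) = x * y then pmf r x else 0)"
      by (rule sum_mono2) auto
    finally show ?thesis unfolding True by auto
  next
    case False
    then obtain u u' where u: "u \<in> S" "u' \<in> S" "u \<noteq> u'" "crosses c y u u'"
      by (auto simp: P_def)
    have "{(x, x')\<in>P. crosses c y x x'} = {(u, u'), (u', u)}"
      using u crosses_sym[of c y u u'] simple_crossingsD[OF c _ _ u(1,2) _ u(3) _ u(4)]
      by (auto simp: P_def doubleton_eq_iff)
    then have "p + (\<Sum>(x, x')\<in>{(x, x')\<in>P. crosses c y x x'}. ?h x x' / 2) = pmf r u + pmf r u'"
      using u(3) by (simp add: field_simps)
    also have "\<dots> = (\<Sum>x\<in>{u, u'}. if c x + (u * y - c u) = x * y then pmf r x else 0)"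
      using u by (simp add: crosses_def algebra_simps)
    also have "\<dots> \<le> (\<Sum>x\<in>UNIV. if c x + (u * y - c u) = x * y then pmf r x else 0)"
      by (rule sum_mono2) auto
    finally show ?thesis by blast
  qed
  then have "\<forall>y. \<exists>v. ?Q y v" ..
  then obtain b where b: "\<forall>y. ?Q y (b y)" by (rule choice[THEN exE])
  have "sum (pmf r) S = sum (pmf r) UNIV"
    by (rule sum.mono_neutral_left) (auto simp: supp)
  then have r1: "sum (pmf r) S = 1" by (simp add: sum_pmf_eq_1)
  \<comment> \<open>After exchanging the sums, each pair contributes its gain once, since it crosses
    over exactly one \<open>y\<close>.\<close>
  have one: "(\<Sum>y\<in>UNIV. if crosses c y x x' then t else 0) = t" if "(x, x') \<in> P" for x x' and t :: real
    using that by (auto simp: P_def crosses_iff)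
  have "(\<Sum>y\<in>UNIV. \<Sum>(x, x')\<in>{(x, x')\<in>P. crosses c y x x'}. ?h x x' / 2)
      = (\<Sum>y\<in>UNIV. \<Sum>(x, x')\<in>P. if crosses c y x x' then ?h x x' / 2 else 0)"
    by (rule sum.cong[OF refl], rule sum.mono_neutral_cong_left) (auto split: if_splits)
  also have "\<dots> = (\<Sum>(x, x')\<in>P. \<Sum>y\<in>UNIV. if crosses c y x x' then ?h x x' / 2 else 0)"
    by (subst sum.swap) (simp add: case_prod_unfold)
  also have "\<dots> = (\<Sum>(x, x')\<in>P. ?h x x' / 2)"
    by (rule sum.cong) (auto simp: one)
  also have "\<dots> = (\<Sum>x\<in>S. \<Sum>x'\<in>S - {x}. ?h x x') / 2"
    unfolding P_def by (simp add: sum.Sigma sum_divide_distrib case_prod_unfold)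
  also have "\<dots> = (real (card S) - 1) * (1 - card S * p / 2)"
    using sum_ordered_pairs[OF finite r1, of p] by simp
  finally have "CARD('a) * p + (real (card S) - 1) * (1 - card S * p / 2)
      = (\<Sum>y\<in>UNIV. p + (\<Sum>(x, x')\<in>{(x, x')\<in>P. crosses c y x x'}. ?h x x' / 2))"
    by (simp add: sum.distrib)
  also have "\<dots> \<le> (\<Sum>y\<in>UNIV. \<Sum>x\<in>UNIV. if c x + b y = x * y then pmf r x else 0)"
    by (rule sum_mono) (rule b[rule_format])
  also have "\<dots> = (\<Sum>x\<in>UNIV. \<Sum>y\<in>UNIV. if c x + b y = x * y then pmf r x else 0)"
    by (rule sum.swap)
  also have "\<dots> = CARD('a) * chsh_win_prob r c b"
    unfolding chsh_win_prob_def chsh_wins_def sum_distrib_left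
    by (intro sum.cong) auto
  finally have "p + (real (card S) - 1) * (1 - card S * p / 2) / CARD('a) \<le> chsh_win_prob r c b"
    by (simp add: field_simps)
  then show ?thesis by auto
qed

theorem theoremV1:
  fixes p :: real and q :: nat and n :: int
  assumes q: "q = CARD('a::{field,finite})"
    and p: "0 < p" "p \<le> 1"
    and n: "n = \<lceil>1 / p\<rceil>"
    and q_large: "real q > (real_of_int n - 1) * ((real_of_int n - 2)\<^sup>2 / 2 + 1)"
  shows "chsh_value TYPE('a) p \<ge>
    p + (real_of_int n - 1) / real q * (1 - real_of_int n * p / 2)"
proof -
  define m where "m = nat n"
  have "1 \<le> 1 / p" using p by simp
  then have "1 \<le> n" unfolding n by linarith
  then have m: "real m = real_of_int n" "1 \<le> m" unfolding m_def by auto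
  note q_large = q_large[folded m(1)]
  \<comment> \<open>The summand 1 in the hypothesis on \<open>q\<close> ensures that the field has
    at least \<open>m\<close> slopes.\<close>
  have "(real m - 1) * 1 \<le> (real m - 1) * ((real m - 2)\<^sup>2 / 2 + 1)"
    using m by (intro mult_left_mono) auto
  with q_large have "real m - 1 < real q" by simp
  then have "m \<le> q" by linarith
  then obtain S :: "'a set" where S: "card S = m"
    using obtain_subset_with_card_n[of m "UNIV :: 'a set"] q by auto
  \<comment> \<open>The other summand is the greedy bound: for \<open>m \<ge> 2\<close> the left
    side equals \<open>(m - 1) * (m - 2)\<^sup>2 / 2\<close> over the reals. For
    \<open>m = 1\<close> truncated subtraction makes it 0.\<close>
  have "(m - 2) * ((m - 1) choose 2) < q"
  proof (cases "m \<ge> 2")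
    case True
    then obtain k where k: "m = k + 2" by (metis add.commute le_Suc_ex)
    have "real ((k + 1) choose 2) = (k + 1) * k / 2"
      by (subst choose_two) (simp add: real_of_nat_div)
    then have "real ((m - 2) * ((m - 1) choose 2)) = (real m - 1) * ((real m - 2)\<^sup>2 / 2)"
      using k by (simp add: power2_eq_square algebra_simps)
    also have "\<dots> \<le> (real m - 1) * ((real m - 2)\<^sup>2 / 2 + 1)"
      using m by (intro mult_left_mono) auto
    finally show ?thesis using q_large m by linarith
  next
    case False
    then show ?thesis using m \<open>m \<le> q\<close> by simp
  qed
  then obtain c where c: "simple_crossings S c"
    using ex_simple_crossings[of S] S q by auto
  \<comment> \<open>These two bounds are the defining inequalities of the ceiling.\<close>
  have "1 / p \<le> card S" "real (card S) - 1 < 1 / p"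
    using S m n by linarith+
  from ex_concentrated_pmf[OF p this] obtain r :: "'a pmf" and x1
    where r: "\<And>x. pmf r x \<le> p" "\<And>x. x \<notin> S \<Longrightarrow> pmf r x = 0" "x1 \<in> S" "pmf r x1 = p" by blast
  obtain b where b: "chsh_win_prob r c b \<ge> p + (real m - 1) / q * (1 - m * p / 2)"
    using chsh_win_prob_simple_crossings[OF c r(2-4)] S q by auto
  have "r \<in> chsh_inputs p" using r(1) by (simp add: chsh_inputs_iff)
  then have "chsh_win_prob r c b \<le> chsh_value TYPE('a) p"
    by (intro chsh_value_attained(2)) auto
  with b m show ?thesis by simp
qed

end
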